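(* Let $F=0$ be a differential-algebraic equation (DAE) of size $n$ in $x_1,\dots,x_n$, let $\psi(\underline{x})$ be a scalar expression, let $R\subseteq\{1,\dots,n\}$, and for each $r\in R$ let $\overline{F}_r(\underline{x},u)$ be obtained from the expression $F_r(\underline{x})$ by replacing one or more occurrences of $\psi(\underline{x})$ by a new variable $u$, so that $F_r(\underline{x})=\overline{F}_r(\underline{x},\psi(\underline{x}))$ and no derivative $\dot u,\ddot u,\dots$ occurs in $\overline{F}_r$. For $i\in\{1,\dots,n\}\setminus R$ put $\overline{F}_i(\underline{x},u):=F_i(\underline{x})$, and put $\overline{F}_{n+1}(\underline{x},u):=u-\psi(\underline{x})$. Let $\overline{F}=0$ be the resulting DAE of size $n+1$ in the variables $x_1,\dots,x_n,x_{n+1}=u$. If $F=0$ is structurally amenable, then $\overline{F}=0$ is structurally amenable.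
   Context: A DAE of size $n$ is a system $F_i(t,\text{the }x_j\text{ and derivatives of them})=0$, $i=1,\dots,n$, in unknown functions $x_j=x_j(t)$, $j=1,\dots,n$; it is written $F=0$ or $F(\underline{x})=0$, where $\underline{x}$ denotes the vector of $t$ and all derivatives $x_j^{(k)}$, $k\ge 0$, that occur in the $F_i$. All functions are assumed suitably smooth, so that needed derivatives exist. "Occurs" refers to the expressions defining the functions: since $\overline{F}_r$ arises from $F_r$ purely by replacing occurrences of $\psi$ by $u$, any derivative of an $x_j$ that occurs in $F_r$ occurs in $\overline{F}_r$ or in $\psi$ (or both), and every derivative of an $x_j$ occurring in $\overline{F}_r$ ($r\in R$) or in $\psi$ occurs in $F_r$. Replacement is optional: all or only some occurrences of $\psi$ may be replaced. Signature matrix: $\Sigma=(\sigma_{ij})$ is $n\times n$, with $\sigma_{ij}$ the highest order of derivative of $x_j$ occurring in $F_i$ (the 0th derivative being $x_j$ itself), or $-\infty$ if $x_j$ does not occur in $F_i$. A transversal is a set of $n$ positions $(i,j)$ with exactly one in each row and each column. Offsets: a pair of integer vectors $c=(c_1,\dots,c_n)$, $d=(d_1,\dots,d_n)$. They are valid if $d_j-c_i\ge\sigma_{ij}$ for all $i,j$, with equality for all $(i,j)$ on some transversal. System Jacobian: for valid offsets $(c,d)$, $\mathbf{J}=(\mathbf{J}_{ij})$ is the $n\times n$ matrix with $\mathbf{J}_{ij}=\partial F_i/\partial x_j^{(\sigma_{ij})}$ if $d_j-c_i=\sigma_{ij}$, and $\mathbf{J}_{ij}=0$ otherwise. The DAE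 is structurally amenable (S-amenable) if there are valid offsets for which $\mathbf{J}$ is nonsingular somewhere, i.e. at some consistent point of the DAE (a point lying on a solution path). *)

theory Defs
  imports "HOL-Analysis.Analysis" "HOL-Library.Extended" "Jordan_Normal_Form.Determinant"
begin

text \<open>
  Since the notion of occurrence concerns the expressions defining the equations, expressions are
  terms. \<open>Der j k\<close> is the derivative of order \<open>k\<close> of the unknown \<open>x j\<close> (the unknown itself
  for \<open>k = 0\<close>), and \<open>Op D f es\<close> applies the function \<open>f\<close> with domain \<open>D\<close>, of arity
  \<open>length es\<close>; \<open>f\<close> can be any function, so equations need not be of elementary form.
  Constants are operators of arity 0. Unknowns and equations are numbered from 0.
\<close>

datatype expr =
    Time
  | Der nat nat
  | Op "real list set" "real list \<Rightarrow> real" "expr list"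

text \<open>A point consists of a time \<open>t\<close> and a value \<open>q j k\<close> for each derivative \<open>Der j k\<close>.\<close>

fun eval :: "real \<Rightarrow> (nat \<Rightarrow> nat \<Rightarrow> real) \<Rightarrow> expr \<Rightarrow> real" where
  "eval t q Time = t"
| "eval t q (Der j k) = q j k"
| "eval t q (Op D f es) = f (map (eval t q) es)"

fun defined_at :: "real \<Rightarrow> (nat \<Rightarrow> nat \<Rightarrow> real) \<Rightarrow> expr \<Rightarrow> bool" where
  "defined_at t q Time = True"
| "defined_at t q (Der j k) = True"
| "defined_at t q (Op D f es) =
     ((\<forall>e\<in>set es. defined_at t q e) \<and> map (eval t q) es \<in> D)"

fun occ :: "expr \<Rightarrow> (nat \<times> nat) set" where
  "occ Time = {}"
| "occ (Der j k) = {(j, k)}"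
| "occ (Op D f es) = (\<Union>e\<in>set es. occ e)"

text \<open>
  \<open>f\<close> is continuously differentiable on the open subset \<open>D\<close> of \<open>m\<close>-dimensional space, whose points
  are lists of length \<open>m\<close>. Topological notions are taken from the product topology on
  \<open>nat \<Rightarrow> real\<close> by restricting to the first \<open>m\<close> coordinates.
\<close>

definition C1_on :: "nat \<Rightarrow> real list set \<Rightarrow> (real list \<Rightarrow> real) \<Rightarrow> bool" where
  "C1_on m D f \<longleftrightarrow>
     (\<forall>ys\<in>D. length ys = m) \<and>
     open {y :: nat \<Rightarrow> real. map y [0..<m] \<in> D} \<and>
     (\<exists>f'. \<forall>i<m.
        (\<forall>ys\<in>D. ((\<lambda>s. f (ys[i := s])) has_real_derivative f' i ys) (at (ys ! i))) \<and>
        continuous_on {y :: nat \<Rightarrow> real. map y [0..<m] \<in> D} (\<lambda>y. f' i (map y [0..<m])))"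

fun smooth :: "expr \<Rightarrow> bool" where
  "smooth Time = True"
| "smooth (Der j k) = True"
| "smooth (Op D f es) = ((\<forall>e\<in>set es. smooth e) \<and> C1_on (length es) D f)"

definition pderiv_expr ::
    "expr \<Rightarrow> nat \<Rightarrow> nat \<Rightarrow> real \<Rightarrow> (nat \<Rightarrow> nat \<Rightarrow> real) \<Rightarrow> real" where
  "pderiv_expr e j k t q = deriv (\<lambda>s. eval t (q(j := (q j)(k := s))) e) (q j k)"

text \<open>
  A DAE of size \<open>n\<close> is given by expressions \<open>F i\<close>, \<open>i < n\<close>, in the unknowns \<open>x j\<close>, \<open>j < n\<close>;
  the values of \<open>F\<close> from \<open>n\<close> on are irrelevant.
\<close>

definition is_dae :: "nat \<Rightarrow> (nat \<Rightarrow> expr) \<Rightarrow> bool" where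
  "is_dae n F \<longleftrightarrow> (\<forall>i<n. smooth (F i) \<and> occ (F i) \<subseteq> {..<n} \<times> UNIV)"

definition dae_occ :: "nat \<Rightarrow> (nat \<Rightarrow> expr) \<Rightarrow> (nat \<times> nat) set" where
  "dae_occ n F = (\<Union>i<n. occ (F i))"

definition sigma :: "(nat \<Rightarrow> expr) \<Rightarrow> nat \<Rightarrow> nat \<Rightarrow> int extended" where
  "sigma F i j =
     (if \<exists>k. (j, k) \<in> occ (F i) then Fin (int (Max {k. (j, k) \<in> occ (F i)})) else Minf)"

definition transversal :: "nat \<Rightarrow> (nat \<times> nat) set \<Rightarrow> bool" where
  "transversal n T \<longleftrightarrow>
     T \<subseteq> {..<n} \<times> {..<n} \<and> (\<forall>i<n. \<exists>!j. (i, j) \<in> T) \<and> (\<forall>j<n. \<exists>!i. (i, j) \<in> T)"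

definition valid_offsets ::
    "nat \<Rightarrow> (nat \<Rightarrow> expr) \<Rightarrow> (nat \<Rightarrow> int) \<Rightarrow> (nat \<Rightarrow> int) \<Rightarrow> bool" where
  "valid_offsets n F c d \<longleftrightarrow>
     (\<forall>i<n. \<forall>j<n. Fin (d j - c i) \<ge> sigma F i j) \<and>
     (\<exists>T. transversal n T \<and> (\<forall>(i, j)\<in>T. Fin (d j - c i) = sigma F i j))"

text \<open>In the first case below \<open>d j - c i\<close> is an order of derivative, hence nonnegative.\<close>

definition system_jacobian ::
    "nat \<Rightarrow> (nat \<Rightarrow> expr) \<Rightarrow> (nat \<Rightarrow> int) \<Rightarrow> (nat \<Rightarrow> int) \<Rightarrow>
     real \<Rightarrow> (nat \<Rightarrow> nat \<Rightarrow> real) \<Rightarrow> real Matrix.mat" where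
  "system_jacobian n F c d t q = Matrix.mat n n (\<lambda>(i, j).
     if Fin (d j - c i) = sigma F i j then pderiv_expr (F i) j (nat (d j - c i)) t q else 0)"

definition Ck_on :: "nat \<Rightarrow> real set \<Rightarrow> (real \<Rightarrow> real) \<Rightarrow> bool" where
  "Ck_on k I g \<longleftrightarrow>
     (\<forall>l<k. \<forall>t\<in>I. (deriv ^^ l) g field_differentiable at t) \<and> continuous_on I ((deriv ^^ k) g)"

definition jet :: "(nat \<Rightarrow> real \<Rightarrow> real) \<Rightarrow> real \<Rightarrow> nat \<Rightarrow> nat \<Rightarrow> real" where
  "jet x t j k = (deriv ^^ k) (x j) t"

definition is_solution ::
    "nat \<Rightarrow> (nat \<Rightarrow> expr) \<Rightarrow> real set \<Rightarrow> (nat \<Rightarrow> real \<Rightarrow> real) \<Rightarrow> bool" where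
  "is_solution n F I x \<longleftrightarrow>
     open I \<and> is_interval I \<and> I \<noteq> {} \<and>
     (\<forall>(j, k)\<in>dae_occ n F. Ck_on k I (x j)) \<and>
     (\<forall>t\<in>I. \<forall>i<n. defined_at t (jet x t) (F i) \<and> eval t (jet x t) (F i) = 0)"

text \<open>Only the coordinates of \<open>q\<close> belonging to derivatives occurring in the DAE are significant.\<close>

definition consistent_point ::
    "nat \<Rightarrow> (nat \<Rightarrow> expr) \<Rightarrow> real \<Rightarrow> (nat \<Rightarrow> nat \<Rightarrow> real) \<Rightarrow> bool" where
  "consistent_point n F t q \<longleftrightarrow>
     (\<exists>I x. is_solution n F I x \<and> t \<in> I \<and> (\<forall>(j, k)\<in>dae_occ n F. q j k = jet x t j k))"

definition S_amenable :: "nat \<Rightarrow> (nat \<Rightarrow> expr) \<Rightarrow> bool" where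
  "S_amenable n F \<longleftrightarrow>
     (\<exists>c d. valid_offsets n F c d \<and>
        (\<exists>t q. consistent_point n F t q \<and> Determinant.det (system_jacobian n F c d t q) \<noteq> 0))"

text \<open>
  \<open>replace1 a b e e'\<close>: \<open>e'\<close> arises from \<open>e\<close> by replacing exactly one occurrence of \<open>a\<close> as a
  subexpression by \<open>b\<close>. If \<open>b\<close> is an unknown not occurring in \<open>a\<close>, replacement creates no new
  occurrences of \<open>a\<close>, so the transitive closure of \<open>replace1 a b\<close> is the replacement
  of one or more occurrences of \<open>a\<close> in the original expression.
\<close>

inductive replace1 :: "expr \<Rightarrow> expr \<Rightarrow> expr \<Rightarrow> expr \<Rightarrow> bool" for a b where
  here: "replace1 a b a b"
| arg: "i < length es \<Longrightarrow> replace1 a b (es ! i) e' \<Longrightarrow>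
          replace1 a b (Op D f es) (Op D f (es[i := e']))"

definition Minus :: "expr \<Rightarrow> expr \<Rightarrow> expr" where
  "Minus e e' = Op {ys. length ys = 2} (\<lambda>ys. ys ! 0 - ys ! 1) [e, e']"

text \<open>
  \<open>\<psi>\<close> is a scalar expression in time and the derivatives occurring in the DAE, smooth and defined
  wherever the DAE is. If \<open>\<psi>\<close> is a subexpression of some \<open>F i\<close>, \<open>i < n\<close>, of a DAE, this is automatic.
\<close>

definition scalar_expr_of :: "nat \<Rightarrow> (nat \<Rightarrow> expr) \<Rightarrow> expr \<Rightarrow> bool" where
  "scalar_expr_of n F \<psi> \<longleftrightarrow>
     smooth \<psi> \<and> occ \<psi> \<subseteq> dae_occ n F \<and>
     (\<forall>t q. (\<forall>i<n. defined_at t q (F i)) \<longrightarrow> defined_at t q \<psi>)"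

end

theory Submission imports Defs begin

text \<open>
  Give the new equation and the new unknown \<open>u\<close> the same offset \<open>m\<close>, with \<open>c r \<le> m\<close> for \<open>r \<in> R\<close>
  and \<open>m \<le> d j - k\<close> for every derivative \<open>Der j k\<close> in \<open>\<psi>\<close>, and keep the old offsets otherwise.
  The chain rule applied to \<open>F r = Fbar r\<close> along \<open>u = \<psi>\<close> says that eliminating the last column of
  the new Jacobian against its last row, whose corner entry is 1, yields the old Jacobian. So the
  two determinants agree at corresponding points, and a nonzero determinant forces a transversal on
  which the offset inequalities are equalities. Solutions correspond by setting \<open>u = \<psi>\<close>.
\<close>

subsection \<open>Chain rule for expressions\<close>

text \<open>A basic open box around \<open>y0\<close> lies in the preimage. Coordinates from
  \<open>m\<close> on do not enter the list and can be reset to those of \<open>y0\<close>; the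
  finitely many remaining radii have a positive minimum.\<close>

lemma open_list_preimage_box:
  assumes op: "open {y :: nat \<Rightarrow> real. map y [0..<m] \<in> T}" and y0: "map y0 [0..<m] \<in> T"
  shows "\<exists>\<epsilon>>0. \<forall>y. (\<forall>j<m. \<bar>y j - y0 j\<bar> < \<epsilon>) \<longrightarrow> map y [0..<m] \<in> T"
proof -
  obtain X where X: "y0 \<in> (\<Pi>\<^sub>E i\<in>UNIV. X i)" "\<And>i. open (X i)"
    "(\<Pi>\<^sub>E i\<in>UNIV. X i) \<subseteq> {y. map y [0..<m] \<in> T}"
    using product_topology_open_contains_basis[OF op[unfolded open_fun_def], of y0] y0 by auto
  have "\<exists>e>0. \<forall>s. \<bar>s - y0 j\<bar> < e \<longrightarrow> s \<in> X j" for j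
    using X(1) open_dist[of "X j"] X(2)[of j] by (auto simp: dist_real_def PiE_iff)
  then obtain e where e: "\<And>j. e j > 0" "\<And>j s. \<bar>s - y0 j\<bar> < e j \<Longrightarrow> s \<in> X j" by metis
  \<comment> \<open>The element 1 keeps the set nonempty when \<open>m = 0\<close>.\<close>
  define \<epsilon> where "\<epsilon> = Min (insert 1 (e ` {..<m}))"
  have pos: "\<epsilon> > 0" unfolding \<epsilon>_def using e(1) by simp
  have le: "\<epsilon> \<le> e j" if "j < m" for j unfolding \<epsilon>_def using that by (intro Min_le) auto
  have "map y [0..<m] \<in> T" if y: "\<forall>j<m. \<bar>y j - y0 j\<bar> < \<epsilon>" for y
  proof -
    have "(\<lambda>j. if j < m then y j else y0 j) \<in> (\<Pi>\<^sub>E i\<in>UNIV. X i)"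
      using y le X(1) e(2) by (force simp: PiE_iff)
    then have "map (\<lambda>j. if j < m then y j else y0 j) [0..<m] \<in> T" using X(3) by auto
    moreover have "map (\<lambda>j. if j < m then y j else y0 j) [0..<m] = map y [0..<m]" by simp
    ultimately show ?thesis by simp
  qed
  then show ?thesis using pos by blast
qed

text \<open>The derivative is assumed on the whole interval of radius
  \<open>\<bar>b - a\<bar>\<close> around \<open>a\<close>, so that \<open>b\<close> may lie on
  either side of \<open>a\<close> or coincide with it.\<close>

lemma MVT_between:
  fixes f :: "real \<Rightarrow> real"
  assumes "\<And>x. \<bar>x - a\<bar> \<le> \<bar>b - a\<bar> \<Longrightarrow> (f has_real_derivative f' x) (at x)"
  shows "\<exists>\<xi>. \<bar>\<xi> - a\<bar> \<le> \<bar>b - a\<bar> \<and> f b - f a = f' \<xi> * (b - a)"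
proof -
  consider "a < b" | "b < a" | "a = b" by linarith
  then show ?thesis
  proof cases
    case 1
    then obtain z where "a < z" "z < b" "f b - f a = (b - a) * f' z"
      using MVT2[of a b f f'] assms by auto
    then show ?thesis by (intro exI[of _ z]) (auto simp: mult.commute)
  next
    case 2
    then obtain z where "b < z" "z < a" "f a - f b = (a - b) * f' z"
      using MVT2[of b a f f'] assms by auto
    then show ?thesis by (intro exI[of _ z]) (auto simp: algebra_simps)
  qed auto
qed

text \<open>
  The increment is telescoped through points that change one coordinate at a time; \<open>\<phi> i\<close>
  is the difference quotient of the \<open>i\<close>-th step.
\<close>

lemma C1_on_slopes:
  fixes g :: "nat \<Rightarrow> 'x \<Rightarrow> real"
  assumes C1: "C1_on m D f" and y0: "map y0 [0..<m] \<in> D"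
    and g: "\<And>i. i < m \<Longrightarrow> (g i \<longlongrightarrow> y0 i) \<F>"
  shows "\<exists>a \<phi>. (\<forall>i<m. (\<phi> i \<longlongrightarrow> a i) \<F>) \<and>
    (\<forall>\<^sub>F x in \<F>. f (map (\<lambda>i. g i x) [0..<m]) =
       f (map y0 [0..<m]) + (\<Sum>i<m. \<phi> i x * (g i x - y0 i)))"
proof -
  let ?l = "\<lambda>y. map y [0..<m]"
  let ?U = "{y :: nat \<Rightarrow> real. ?l y \<in> D}"
  obtain f' where f': "\<And>i ys. i < m \<Longrightarrow> ys \<in> D \<Longrightarrow>
        ((\<lambda>s. f (ys[i := s])) has_real_derivative f' i ys) (at (ys ! i))"
      "\<And>i. i < m \<Longrightarrow> continuous_on ?U (\<lambda>y. f' i (?l y))"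
    and op: "open ?U"
    using C1 unfolding C1_on_def by blast
  define a where "a i = f' i (?l y0)" for i
  obtain \<epsilon> where \<epsilon>: "\<epsilon> > 0" "\<And>y. (\<forall>j<m. \<bar>y j - y0 j\<bar> < \<epsilon>) \<Longrightarrow> ?l y \<in> D"
    using open_list_preimage_box[OF op y0] by blast
  \<comment> \<open>The lists in \<open>D\<close> at which the \<open>i\<close>-th partial
    derivative is within \<open>e\<close> of \<open>a i\<close> again have an open preimage, which
    therefore contains a box around \<open>y0\<close>.\<close>
  have near: "\<exists>\<delta>>0. \<forall>y. (\<forall>j<m. \<bar>y j - y0 j\<bar> < \<delta>) \<longrightarrow> \<bar>f' i (?l y) - a i\<bar> < e"
    if "i < m" "e > 0" for i e
  proof -
    let ?T = "{ys \<in> D. \<bar>f' i ys - a i\<bar> < e}"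
    have "open (?U \<inter> (\<lambda>y. f' i (?l y)) -` ball (a i) e)"
      by (rule continuous_open_preimage[OF f'(2) op]) (use that in auto)
    moreover have "?U \<inter> (\<lambda>y. f' i (?l y)) -` ball (a i) e = {y. ?l y \<in> ?T}"
      by (auto simp: dist_real_def abs_minus_commute)
    ultimately have "open {y. ?l y \<in> ?T}" by simp
    moreover have "?l y0 \<in> ?T" using y0 that by (auto simp: a_def)
    ultimately show ?thesis using open_list_preimage_box[of m ?T y0] by blast
  qed
  have ev: "\<forall>\<^sub>F x in \<F>. \<forall>j\<in>{..<m}. \<bar>g j x - y0 j\<bar> < \<delta>" if "\<delta> > 0" for \<delta>
    using g that by (intro eventually_ball_finite) (auto simp: tendsto_iff dist_real_def)
  \<comment> \<open>The path from \<open>y0\<close> to the point given by \<open>g\<close> moves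
    along one axis at a time: \<open>h x i\<close> is its \<open>i\<close>-th corner, and
    \<open>w x i\<close> parametrises the edge from \<open>h x i\<close> to
    \<open>h x (Suc i)\<close>.\<close>
  define h where "h x i = (\<lambda>j. if j < i then g j x else y0 j)" for x and i :: nat
  define w where "w x i s = (h x i)(i := s)" for x i and s :: real
  have w: "w x i (y0 i) = h x i" "w x i (g i x) = h x (Suc i)" for x i
    by (auto simp: w_def h_def fun_eq_iff less_Suc_eq)
  have close: "\<forall>j<m. \<bar>w x i s j - y0 j\<bar> < \<delta>"
    if "\<forall>j<m. \<bar>g j x - y0 j\<bar> < \<delta>" "\<bar>s - y0 i\<bar> \<le> \<bar>g i x - y0 i\<bar>" "i < m" "\<delta> > 0"
    for x i s \<delta>
    using that by (auto simp: w_def h_def intro: le_less_trans)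
  \<comment> \<open>On an edge, \<open>f\<close> is a function of one real variable, and the whole
    edge stays in the box inside \<open>D\<close>, so the mean value theorem applies.\<close>
  have step: "\<exists>\<xi>. \<bar>\<xi> - y0 i\<bar> \<le> \<bar>g i x - y0 i\<bar> \<and>
      f (?l (h x (Suc i))) - f (?l (h x i)) = f' i (?l (w x i \<xi>)) * (g i x - y0 i)"
    if x: "\<forall>j<m. \<bar>g j x - y0 j\<bar> < \<epsilon>" and i: "i < m" for x i
  proof -
    have "((\<lambda>s. f (?l (w x i s))) has_real_derivative f' i (?l (w x i s))) (at s)"
      if "\<bar>s - y0 i\<bar> \<le> \<bar>g i x - y0 i\<bar>" for s
    proof -
      have "?l (w x i s) \<in> D" using \<epsilon> close[OF x that i] by blast
      from f'(1)[OF i this] have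
        "((\<lambda>s'. f ((?l (w x i s))[i := s'])) has_real_derivative f' i (?l (w x i s))) (at s)"
        using i by (simp add: w_def)
      moreover have "(?l (w x i s))[i := s'] = ?l (w x i s')" for s'
        by (rule nth_equalityI) (auto simp: w_def nth_list_update)
      ultimately show ?thesis by simp
    qed
    from MVT_between[of "y0 i" "g i x", OF this] show ?thesis by (auto simp: w)
  qed
  \<comment> \<open>The default \<open>a i\<close> for a step of length zero keeps the limit right;
    the quotient would be 0 there.\<close>
  define \<phi> where "\<phi> i x = (if g i x = y0 i then a i
      else (f (?l (h x (Suc i))) - f (?l (h x i))) / (g i x - y0 i))" for i x
  have "(\<phi> i \<longlongrightarrow> a i) \<F>" if i: "i < m" for i
  proof (rule tendstoI)
    fix e :: real assume e: "e > 0"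
    obtain \<delta> where \<delta>: "\<delta> > 0"
      "\<And>y. (\<forall>j<m. \<bar>y j - y0 j\<bar> < \<delta>) \<Longrightarrow> \<bar>f' i (?l y) - a i\<bar> < e"
      using near[OF i e] by blast
    from ev[OF \<epsilon>(1)] ev[OF \<delta>(1)] show "\<forall>\<^sub>F x in \<F>. dist (\<phi> i x) (a i) < e"
    proof eventually_elim
      case (elim x)
      then obtain \<xi> where \<xi>: "\<bar>\<xi> - y0 i\<bar> \<le> \<bar>g i x - y0 i\<bar>"
        "f (?l (h x (Suc i))) - f (?l (h x i)) = f' i (?l (w x i \<xi>)) * (g i x - y0 i)"
        using step[of x i] i by auto
      have "\<bar>f' i (?l (w x i \<xi>)) - a i\<bar> < e"
        using \<delta> close[OF _ \<xi>(1) i \<delta>(1)] elim by blast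
      then show ?case using \<xi>(2) e by (auto simp: \<phi>_def dist_real_def)
    qed
  qed
  moreover have "\<forall>\<^sub>F x in \<F>. f (map (\<lambda>i. g i x) [0..<m]) =
     f (map y0 [0..<m]) + (\<Sum>i<m. \<phi> i x * (g i x - y0 i))"
    using ev[OF \<epsilon>(1)]
  proof eventually_elim
    case (elim x)
    have "\<phi> i x * (g i x - y0 i) = f (?l (h x (Suc i))) - f (?l (h x i))" if "i < m" for i
      using step[of x i] elim that by (auto simp: \<phi>_def)
    then have "(\<Sum>i<m. \<phi> i x * (g i x - y0 i)) = (\<Sum>i<m. f (?l (h x (Suc i))) - f (?l (h x i)))"
      by simp
    also have "\<dots> = f (?l (h x m)) - f (?l (h x 0))" by (rule sum_lessThan_telescope)
    also have "?l (h x m) = map (\<lambda>i. g i x) [0..<m]" by (simp add: h_def)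
    also have "?l (h x 0) = ?l y0" by (simp add: h_def)
    finally show ?case by simp
  qed
  ultimately show ?thesis by blast
qed

text \<open>The factor \<phi> merely converges, but \<open>h\<close> vanishes at \<open>x\<close>.
  The error splits into \<phi> times the error of \<open>h\<close>, and \<open>\<phi> - a\<close>
  times the linear part \<open>h'\<close>; the latter is small because \<open>h'\<close> is
  bounded.\<close>

lemma has_derivative_mult_vanishing:
  fixes h \<phi> :: "'x::real_normed_vector \<Rightarrow> real"
  assumes h: "(h has_derivative h') (at x)" "h x = 0" and \<phi>: "(\<phi> \<longlongrightarrow> a) (at x)"
  shows "((\<lambda>y. \<phi> y * h y) has_derivative (\<lambda>v. a * h' v)) (at x)"
proof -
  interpret h': bounded_linear h' using h(1) by (rule has_derivative_bounded_linear)
  obtain K where K: "\<And>v. norm (h' v) \<le> norm v * K" using h'.bounded by blast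
  have lim: "((\<lambda>y. (h y - h' (y - x)) / norm (y - x)) \<longlongrightarrow> 0) (at x)"
    using h unfolding has_derivative_at_within by (simp add: divide_inverse_commute)
  have "((\<lambda>y. (\<phi> y - a) * (h' (y - x) / norm (y - x))) \<longlongrightarrow> 0) (at x)"
  proof (rule Lim_null_comparison)
    show "\<forall>\<^sub>F y in at x. norm ((\<phi> y - a) * (h' (y - x) / norm (y - x))) \<le> \<bar>\<phi> y - a\<bar> * \<bar>K\<bar>"
    proof (intro always_eventually allI)
      fix y
      have "\<bar>h' (y - x)\<bar> \<le> \<bar>K\<bar> * norm (y - x)"
        using K[of "y - x"] by (smt (verit) mult.commute mult_right_mono norm_ge_zero real_norm_def)
      then have "\<bar>h' (y - x)\<bar> / norm (y - x) \<le> \<bar>K\<bar>"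
        by (cases "y = x") (auto simp: divide_le_eq)
      then show "norm ((\<phi> y - a) * (h' (y - x) / norm (y - x))) \<le> \<bar>\<phi> y - a\<bar> * \<bar>K\<bar>"
        using mult_left_mono[of _ _ "\<bar>\<phi> y - a\<bar>"] by (fastforce simp: abs_mult)
    qed
    show "((\<lambda>y. \<bar>\<phi> y - a\<bar> * \<bar>K\<bar>) \<longlongrightarrow> 0) (at x)"
      using \<phi> by (auto intro!: tendsto_eq_intros)
  qed
  moreover have "((\<lambda>y. \<phi> y * ((h y - h' (y - x)) / norm (y - x))) \<longlongrightarrow> 0) (at x)"
    using tendsto_mult[OF \<phi> lim] by simp
  ultimately have "((\<lambda>y. \<phi> y * ((h y - h' (y - x)) / norm (y - x)) +
      (\<phi> y - a) * (h' (y - x) / norm (y - x))) \<longlongrightarrow> 0 + 0) (at x)"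
    by (intro tendsto_add)
  moreover have "\<phi> y * ((h y - h' (y - x)) / norm (y - x)) +
      (\<phi> y - a) * (h' (y - x) / norm (y - x)) =
      (\<phi> y * h y - \<phi> x * h x - a * h' (y - x)) / norm (y - x)" for y
    using h(2) by (simp add: algebra_simps add_divide_distrib diff_divide_distrib)
  ultimately show ?thesis
    unfolding has_derivative_at_within
    by (simp add: divide_inverse_commute h'.bounded_linear_axioms bounded_linear_const_mult)
qed

lemma C1_on_tendsto:
  fixes g :: "nat \<Rightarrow> 'x \<Rightarrow> real"
  assumes C1: "C1_on m D f" and y0: "map y0 [0..<m] \<in> D"
    and g: "\<And>i. i < m \<Longrightarrow> (g i \<longlongrightarrow> y0 i) \<F>"
  shows "((\<lambda>x. f (map (\<lambda>i. g i x) [0..<m])) \<longlongrightarrow> f (map y0 [0..<m])) \<F>"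
proof -
  obtain a \<phi> where \<phi>: "\<forall>i<m. (\<phi> i \<longlongrightarrow> a i) \<F>"
    and eq: "\<forall>\<^sub>F x in \<F>. f (map (\<lambda>i. g i x) [0..<m]) =
       f (map y0 [0..<m]) + (\<Sum>i<m. \<phi> i x * (g i x - y0 i))"
    using C1_on_slopes[OF C1 y0 g] by blast
  have "((\<lambda>x. f (map y0 [0..<m]) + (\<Sum>i<m. \<phi> i x * (g i x - y0 i))) \<longlongrightarrow>
      f (map y0 [0..<m]) + (\<Sum>i<m. a i * (y0 i - y0 i))) \<F>"
    using \<phi> g by (intro tendsto_intros) auto
  then show ?thesis by (subst tendsto_cong[OF eq]) simp
qed

text \<open>\<open>C1_on\<close> provides partial derivatives. Total differentiability follows from
  the expansion into slopes, each summand being a convergent slope times a differentiable factor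
  that vanishes at \<open>x0\<close>.\<close>

lemma C1_on_differentiable:
  fixes g :: "nat \<Rightarrow> 'x::real_normed_vector \<Rightarrow> real"
  assumes C1: "C1_on m D f" and y0: "map (\<lambda>i. g i x0) [0..<m] \<in> D"
    and g: "\<And>i. i < m \<Longrightarrow> g i differentiable at x0"
  shows "(\<lambda>x. f (map (\<lambda>i. g i x) [0..<m])) differentiable at x0"
proof -
  have lim: "(g i \<longlongrightarrow> g i x0) (at x0)" if "i < m" for i
    using differentiable_imp_continuous_within[OF g[OF that]] by (simp add: continuous_within)
  obtain a \<phi> where \<phi>: "\<forall>i<m. (\<phi> i \<longlongrightarrow> a i) (at x0)"
    and eq: "\<forall>\<^sub>F x in at x0. f (map (\<lambda>i. g i x) [0..<m]) =
       f (map (\<lambda>i. g i x0) [0..<m]) + (\<Sum>i<m. \<phi> i x * (g i x - g i x0))"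
    using C1_on_slopes[OF C1 y0 lim] by blast
  obtain g' where g': "\<And>i. i < m \<Longrightarrow> (g i has_derivative g' i) (at x0)"
    using g unfolding differentiable_def by metis
  have "((\<lambda>x. \<phi> i x * (g i x - g i x0)) has_derivative (\<lambda>v. a i * (g' i v - 0))) (at x0)"
    if "i < m" for i
    by (intro has_derivative_mult_vanishing has_derivative_diff has_derivative_const)
      (use g' \<phi> that in auto)
  then have D: "((\<lambda>x. f (map (\<lambda>i. g i x0) [0..<m]) + (\<Sum>i<m. \<phi> i x * (g i x - g i x0)))
      has_derivative (\<lambda>v. 0 + (\<Sum>i<m. a i * (g' i v - 0)))) (at x0)"
    by (intro has_derivative_add has_derivative_sum has_derivative_const) auto
  show ?thesis
    unfolding differentiable_def
    by (rule exI, rule has_derivative_transform_eventually[OF D])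
      (use eq in \<open>auto elim: eventually_mono\<close>)
qed

section \<open>Expressions as functions of time and derivatives\<close>

text \<open>Convergence is asked for the derivatives that occur in \<open>e\<close>, since a
  solution is regular in these. The filter is arbitrary, so that continuity on a set of times is
  covered.\<close>

lemma eval_tendsto:
  fixes T :: "'x \<Rightarrow> real" and \<gamma> :: "'x \<Rightarrow> nat \<Rightarrow> nat \<Rightarrow> real"
  assumes T: "(T \<longlongrightarrow> t) \<F>"
  shows "smooth e \<Longrightarrow> defined_at t q e \<Longrightarrow>
    (\<And>j k. (j, k) \<in> occ e \<Longrightarrow> ((\<lambda>x. \<gamma> x j k) \<longlongrightarrow> q j k) \<F>) \<Longrightarrow>
    ((\<lambda>x. eval (T x) (\<gamma> x) e) \<longlongrightarrow> eval t q e) \<F>"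
proof (induction e)
  case (Op D f es)
  \<comment> \<open>Brings the list of arguments into the indexed form to which the lemmas on
    \<open>C1_on\<close> apply.\<close>
  have eq: "map (\<lambda>i. eval s r (es ! i)) [0..<length es] = map (eval s r) es" for s r
    by (rule nth_equalityI) auto
  have "((\<lambda>x. eval (T x) (\<gamma> x) (es ! i)) \<longlongrightarrow> eval t q (es ! i)) \<F>" if "i < length es" for i
    using Op.prems that by (intro Op.IH) (auto intro!: Op.prems(3) bexI[of _ "es ! i"])
  from C1_on_tendsto[of "length es" D f "\<lambda>i. eval t q (es ! i)", OF _ _ this]
    Op.prems(1,2)
  show ?case by (simp add: eq)
qed (use T in auto)

text \<open>Time is fixed because this serves partial derivatives in the variables
  \<open>Der j k\<close>. The parameter \<open>x\<close> may range over a plane as well as a line,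
  as the chain rule in two variables requires.\<close>

lemma eval_differentiable:
  fixes \<gamma> :: "'x::real_normed_vector \<Rightarrow> nat \<Rightarrow> nat \<Rightarrow> real"
  shows "smooth e \<Longrightarrow> defined_at t (\<gamma> x0) e \<Longrightarrow>
    (\<And>j k. (j, k) \<in> occ e \<Longrightarrow> (\<lambda>x. \<gamma> x j k) differentiable at x0) \<Longrightarrow>
    (\<lambda>x. eval t (\<gamma> x) e) differentiable at x0"
proof (induction e)
  case (Op D f es)
  have eq: "map (\<lambda>i. eval s r (es ! i)) [0..<length es] = map (eval s r) es" for s r
    by (rule nth_equalityI) auto
  have "(\<lambda>x. eval t (\<gamma> x) (es ! i)) differentiable at x0" if "i < length es" for i
    using Op.prems that by (intro Op.IH) (auto intro!: Op.prems(3) bexI[of _ "es ! i"])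
  from C1_on_differentiable[of "length es" D f "\<lambda>i x. eval t (\<gamma> x) (es ! i)", OF _ _ this]
    Op.prems(1,2)
  show ?case by (simp add: eq)
qed auto

lemma finite_occ: "finite (occ e)"
  by (induction e) auto

lemma eval_cong:
  "(\<And>j k. (j, k) \<in> occ e \<Longrightarrow> q j k = q' j k) \<Longrightarrow> eval t q e = eval t q' e"
proof (induction e)
  case (Op D f es)
  then have "map (eval t q) es = map (eval t q') es" by (intro map_cong) auto
  then show ?case by (simp del: map_eq_conv)
qed auto

lemma defined_at_cong:
  "(\<And>j k. (j, k) \<in> occ e \<Longrightarrow> q j k = q' j k) \<Longrightarrow> defined_at t q e = defined_at t q' e"
proof (induction e)
  case (Op D f es)
  then have "map (eval t q) es = map (eval t q') es" by (intro map_cong eval_cong) auto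
  moreover have "defined_at t q e = defined_at t q' e" if "e \<in> set es" for e
    using that Op.prems by (intro Op.IH) auto
  ultimately show ?case by (simp del: map_eq_conv)
qed auto

section \<open>Partial derivatives of expressions\<close>

abbreviation upd :: "(nat \<Rightarrow> nat \<Rightarrow> real) \<Rightarrow> nat \<Rightarrow> nat \<Rightarrow> real \<Rightarrow> nat \<Rightarrow> nat \<Rightarrow> real" where
  "upd q j k s \<equiv> q(j := (q j)(k := s))"

lemma pderiv_expr_not_occ:
  assumes "(j, k) \<notin> occ e"
  shows "pderiv_expr e j k t q = 0"
proof -
  have "eval t (upd q j k s) e = eval t q e" for s
    by (rule eval_cong) (use assms in \<open>auto split: if_splits\<close>)
  then show ?thesis by (simp add: pderiv_expr_def)
qed

text \<open>\<open>deriv\<close> carries information only where a derivative exists; this supplies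
  the existence for \<open>pderiv_expr\<close>.\<close>

lemma eval_upd_differentiable:
  assumes "smooth e" "defined_at t q e"
  shows "(\<lambda>s. eval t (upd q j k s) e) field_differentiable at (q j k)"
proof -
  have "(\<lambda>s. eval t (upd q j k s) e) differentiable at (q j k)"
  proof (rule eval_differentiable)
    show "(\<lambda>s. upd q j k s j' k') differentiable at (q j k)" for j' k'
      by (cases "j' = j"; cases "k' = k") auto
  qed (use assms in auto)
  then show ?thesis
    by (metis field_differentiable_def real_differentiable_def)
qed

text \<open>The roles are: \<open>e\<close> is the rewritten equation, \<open>e0\<close> the
  original one, \<open>a\<close> is \<psi>, and \<open>(n, l)\<close> is the new variable. The two
  equations agree on the graph of \<open>a\<close>, so \<open>e0\<close> is differentiated by moving
  \<open>e\<close> along a curve in that graph.\<close>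

lemma pderiv_expr_subst:
  assumes e: "smooth e" "defined_at t q e" and a: "smooth a" "defined_at t q a" "(n, l) \<notin> occ a"
    and q: "q n l = eval t q a" and ne: "(j, k) \<noteq> (n, l)" and e0: "(n, l) \<notin> occ e0"
    and eq: "\<And>q. q n l = eval t q a \<Longrightarrow> eval t q e = eval t q e0"
  shows "pderiv_expr e0 j k t q =
    pderiv_expr e j k t q + pderiv_expr e n l t q * pderiv_expr a j k t q"
proof -
  define p where "p s = eval t (upd q j k s) a" for s
  \<comment> \<open>\<open>G\<close> restricts \<open>e\<close> to the plane of the two varying
    coordinates. Its total derivative at \<open>(1, 0)\<close>, at \<open>(0, 1)\<close> and at the
    tangent of the graph of \<open>a\<close> gives the three derivatives wanted.\<close>
  define G where "G z = eval t (upd (upd q j k (fst z)) n l (snd z)) e" for z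
  let ?z = "(q j k, q n l)"
  have base: "upd (upd q j k (q j k)) n l (q n l) = q" using ne by (auto simp: fun_eq_iff)
  have "G differentiable at ?z"
    unfolding G_def
  proof (rule eval_differentiable)
    show "(\<lambda>z. upd (upd q j k (fst z)) n l (snd z) j' k') differentiable at ?z" for j' k'
    proof -
      have "fst differentiable at ?z" "snd differentiable at ?z"
        by (auto intro: bounded_linear_imp_differentiable bounded_linear_fst bounded_linear_snd)
      moreover have "(\<lambda>z. upd (upd q j k (fst z)) n l (snd z) j' k') =
        (if (j', k') = (n, l) then snd else if (j', k') = (j, k) then fst else (\<lambda>z. q j' k'))"
        by auto
      ultimately show ?thesis by auto
    qed
  qed (use e base in auto)
  then obtain G' where G': "(G has_derivative G') (at ?z)" by (auto simp: differentiable_def)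
  interpret G': bounded_linear G' using G' by (rule has_derivative_bounded_linear)
  have along: "((\<lambda>s. G (g s, h s)) has_real_derivative G' (g', h')) (at s)"
    if "(g has_real_derivative g') (at s)" "(h has_real_derivative h') (at s)" "(g s, h s) = ?z"
    for g h g' h' s
  proof -
    have "((\<lambda>s. (g s, h s)) has_derivative (\<lambda>v. (g' * v, h' * v))) (at s)"
      using that by (intro has_derivative_Pair) (auto simp: has_field_derivative_def)
    from has_derivative_compose[OF this, of G G'] G' that
    have "((\<lambda>s. G (g s, h s)) has_derivative (\<lambda>v. G' (g' * v, h' * v))) (at s)" by simp
    moreover have "G' (g' * v, h' * v) = G' (g', h') * v" for v
      using G'.scaleR[of v "(g', h')"] by (simp add: mult.commute)
    ultimately show ?thesis by (simp add: has_field_derivative_def)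
  qed
  have pa: "(p has_real_derivative pderiv_expr a j k t q) (at (q j k))"
    using eval_upd_differentiable[OF a(1,2), of j k]
    unfolding p_def pderiv_expr_def by (simp add: field_differentiable_derivI)
  have p0: "p (q j k) = q n l" by (simp add: p_def q)
  have "pderiv_expr e0 j k t q = G' (1, pderiv_expr a j k t q)"
  proof -
    have "G (s, p s) = eval t (upd q j k s) e0" for s
    proof -
      \<comment> \<open>As \<open>(n, l)\<close> does not occur in \<open>a\<close>, setting this
        coordinate to \<open>p s\<close> leaves the value of \<open>a\<close> at \<open>p s\<close>,
        and \<open>eq\<close> applies.\<close>
      have "eval t (upd (upd q j k s) n l (p s)) a = p s"
        unfolding p_def by (rule eval_cong) (use a(3) in auto)
      then have "G (s, p s) = eval t (upd (upd q j k s) n l (p s)) e0"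
        by (simp add: G_def eq)
      also have "\<dots> = eval t (upd q j k s) e0"
        by (rule eval_cong) (use e0 in auto)
      finally show ?thesis .
    qed
    then show ?thesis
      using along[of "\<lambda>s. s" 1 _ p, OF _ pa] p0 by (simp add: pderiv_expr_def DERIV_imp_deriv)
  qed
  moreover have "pderiv_expr e j k t q = G' (1, 0)"
  proof -
    have "G (s, q n l) = eval t (upd q j k s) e" for s
      unfolding G_def by (rule eval_cong) (use ne in auto)
    then show ?thesis
      using along[of "\<lambda>s. s" 1 "q j k" "\<lambda>s. q n l" 0] by (simp add: pderiv_expr_def DERIV_imp_deriv)
  qed
  moreover have "pderiv_expr e n l t q = G' (0, 1)"
  proof -
    have "G (q j k, s) = eval t (upd q n l s) e" for s
      unfolding G_def by (rule eval_cong) (use ne in auto)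
    then show ?thesis
      using along[of "\<lambda>s. q j k" 0 "q n l" "\<lambda>s. s" 1] by (simp add: pderiv_expr_def DERIV_imp_deriv)
  qed
  moreover have "G' (1, pderiv_expr a j k t q) = G' (1, 0) + G' (0, 1) * pderiv_expr a j k t q"
    using G'.add[of "(1, 0)" "(0, pderiv_expr a j k t q)"]
      G'.scaleR[of "pderiv_expr a j k t q" "(0, 1)"] by (simp add: mult.commute)
  ultimately show ?thesis by (simp only:)
qed

lemma pderiv_expr_cong:
  assumes "\<And>j' k'. (j', k') \<in> occ e \<Longrightarrow> q j' k' = q' j' k'"
  shows "pderiv_expr e j k t q = pderiv_expr e j k t q'"
proof (cases "(j, k) \<in> occ e")
  case True
  moreover have "eval t (upd q j k s) e = eval t (upd q' j k s) e" for s
    by (rule eval_cong) (use assms in auto)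
  ultimately show ?thesis using assms by (simp add: pderiv_expr_def)
qed (simp add: pderiv_expr_not_occ)

lemma pderiv_expr_Der: "pderiv_expr (Der n l) j k t q = (if (j, k) = (n, l) then 1 else 0)"
proof (cases "(j, k) = (n, l)")
  case False
  then have "pderiv_expr (Der n l) j k t q = 0" by (intro pderiv_expr_not_occ) auto
  with False show ?thesis by argo
qed (simp add: pderiv_expr_def)

lemma pderiv_expr_Minus:
  assumes "smooth a" "defined_at t q a" "smooth b" "defined_at t q b"
  shows "pderiv_expr (Minus a b) j k t q = pderiv_expr a j k t q - pderiv_expr b j k t q"
  using eval_upd_differentiable[OF assms(1,2)] eval_upd_differentiable[OF assms(3,4)]
  by (simp add: pderiv_expr_def Minus_def)

text \<open>Gives the regularity of the new unknown: \<open>u\<close> occurs in the new system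
  without derivatives, so continuity is enough.\<close>

lemma continuous_on_eval_jet:
  assumes e: "smooth e" "\<And>t. t \<in> I \<Longrightarrow> defined_at t (jet x t) e"
    and x: "\<And>j k. (j, k) \<in> occ e \<Longrightarrow> Ck_on k I (x j)"
  shows "continuous_on I (\<lambda>t. eval t (jet x t) e)"
  unfolding continuous_on_def
proof
  fix t assume t: "t \<in> I"
  show "((\<lambda>t. eval t (jet x t) e) \<longlongrightarrow> eval t (jet x t) e) (at t within I)"
  proof (rule eval_tendsto)
    show "((\<lambda>t. jet x t j k) \<longlongrightarrow> jet x t j k) (at t within I)" if "(j, k) \<in> occ e" for j k
      using x[OF that] t by (auto simp: Ck_on_def jet_def continuous_on_def)
  qed (use e t in auto)
qed

subsection \<open>Replacing occurrences\<close>

lemma replace1_eval: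
  "replace1 a b e e' \<Longrightarrow> eval t q b = eval t q a \<Longrightarrow> eval t q e' = eval t q e"
proof (induction rule: replace1.induct)
  case (arg i es e' D f)
  then have "map (eval t q) (es[i := e']) = map (eval t q) es"
    by (intro nth_equalityI) (auto simp: nth_list_update)
  then show ?case by simp
qed

text \<open>Agreement of the values of \<open>a\<close> and \<open>b\<close> makes all arguments
  keep their values, so they stay in the domains \<open>D\<close>.\<close>

lemma replace1_defined_at:
  "replace1 a b e e' \<Longrightarrow> eval t q b = eval t q a \<Longrightarrow> defined_at t q b \<Longrightarrow>
    defined_at t q e \<Longrightarrow> defined_at t q e'"
proof (induction rule: replace1.induct)
  case (arg i es e' D f)
  have "map (eval t q) (es[i := e']) = map (eval t q) es"
    using arg.hyps replace1_eval[OF arg.hyps(2) arg.prems(1)]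
    by (intro nth_equalityI) (auto simp: nth_list_update)
  moreover have "\<forall>e\<in>set (es[i := e']). defined_at t q e"
    using arg by (auto simp: all_set_conv_all_nth nth_list_update)
  ultimately show ?case using arg.prems by simp
qed

lemma replace1_smooth:
  "replace1 a b e e' \<Longrightarrow> smooth b \<Longrightarrow> smooth e \<Longrightarrow> smooth e'"
proof (induction rule: replace1.induct)
  case (arg i es e' D f)
  then show ?case by (auto simp: all_set_conv_all_nth nth_list_update)
qed

lemma replace1_occ: "replace1 a b e e' \<Longrightarrow> occ e' \<subseteq> occ b \<union> occ e"
proof (induction rule: replace1.induct)
  case (arg i es e' D f)
  have "occ e0 \<subseteq> occ b \<union> (\<Union>e\<in>set es. occ e)" if "e0 \<in> set (es[i := e'])" for e0
    using that arg set_update_subset_insert[of es i e'] nth_mem[of i es] by blast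
  then show ?case by auto
qed auto

lemma replace1_occ_subexpr: "replace1 a b e e' \<Longrightarrow> occ a \<subseteq> occ e"
proof (induction rule: replace1.induct)
  case (arg i es e' D f)
  then show ?case by (auto intro!: bexI[of _ "es ! i"])
qed auto

lemma replace_eval:
  "(replace1 a b)\<^sup>+\<^sup>+ e e' \<Longrightarrow> eval t q b = eval t q a \<Longrightarrow> eval t q e' = eval t q e"
  by (induction rule: tranclp_induct) (auto dest: replace1_eval)

lemma replace_defined_at:
  "(replace1 a b)\<^sup>+\<^sup>+ e e' \<Longrightarrow> eval t q b = eval t q a \<Longrightarrow> defined_at t q b \<Longrightarrow>
    defined_at t q e \<Longrightarrow> defined_at t q e'"
  by (induction rule: tranclp_induct) (auto dest: replace1_defined_at)

lemma replace_smooth: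
  "(replace1 a b)\<^sup>+\<^sup>+ e e' \<Longrightarrow> smooth b \<Longrightarrow> smooth e \<Longrightarrow> smooth e'"
  by (induction rule: tranclp_induct) (auto dest: replace1_smooth)

lemma replace_occ: "(replace1 a b)\<^sup>+\<^sup>+ e e' \<Longrightarrow> occ e' \<subseteq> occ b \<union> occ e"
  by (induction rule: tranclp_induct) (auto dest!: replace1_occ)

text \<open>The first replacement of the chain already finds \<open>a\<close> inside
  \<open>e\<close>. Hence the orders in \<psi> are bounded by the offsets of every row in
  \<open>R\<close>.\<close>

lemma replace_occ_subexpr: "(replace1 a b)\<^sup>+\<^sup>+ e e' \<Longrightarrow> occ a \<subseteq> occ e"
  by (induction rule: tranclp_induct) (auto dest!: replace1_occ_subexpr)

subsection \<open>Signature matrix and Jacobian\<close>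

text \<open>Turns a bound on a maximum, or on \<open>Minf\<close> for an absent unknown, into a
  condition on single occurrences, so that offset inequalities can be checked one occurrence at a
  time.\<close>

lemma sigma_le_iff: "sigma F i j \<le> Fin z \<longleftrightarrow> (\<forall>k. (j, k) \<in> occ (F i) \<longrightarrow> int k \<le> z)"
proof (cases "\<exists>k. (j, k) \<in> occ (F i)")
  case True
  have "finite (Pair j -` occ (F i))" by (intro finite_vimageI finite_occ injI) auto
  then have fin: "finite {k. (j, k) \<in> occ (F i)}" by (simp add: vimage_def)
  define M where "M = Max {k. (j, k) \<in> occ (F i)}"
  have "M \<in> {k. (j, k) \<in> occ (F i)}"
    unfolding M_def using True by (intro Max_in fin) auto
  moreover have "k \<le> M" if "(j, k) \<in> occ (F i)" for k
    unfolding M_def using that by (intro Max_ge fin) auto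
  ultimately have "int M \<le> z \<longleftrightarrow> (\<forall>k. (j, k) \<in> occ (F i) \<longrightarrow> int k \<le> z)"
    by fastforce
  then show ?thesis using True by (simp add: sigma_def M_def)
qed (simp add: sigma_def)

lemma sigma_less_not_occ:
  assumes "sigma F i j \<le> Fin z" "Fin z \<noteq> sigma F i j"
  shows "(j, nat z) \<notin> occ (F i)"
proof
  assume occ: "(j, nat z) \<in> occ (F i)"
  \<comment> \<open>An occurrence forces \<open>z\<close> to be nonnegative, so the truncation in
    \<open>nat z\<close> is harmless.\<close>
  with assms(1) have "int (nat z) \<le> z" using sigma_le_iff by blast
  moreover obtain y where y: "sigma F i j = Fin y"
    using occ by (cases "sigma F i j") (auto simp: sigma_def split: if_splits)
  moreover have "int (nat z) \<le> y" using sigma_le_iff[of F i j y] y occ by (metis order_refl)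
  ultimately have "y \<ge> z" by linarith
  with assms y show False by simp
qed

text \<open>Where the inequality is strict, the derivative of order \<open>nat (d j - c i)\<close>
  does not occur and its partial derivative is 0, so the case distinction in the Jacobian
  disappears.\<close>

lemma system_jacobian_eq:
  assumes "\<And>i j. i < n \<Longrightarrow> j < n \<Longrightarrow> sigma F i j \<le> Fin (d j - c i)"
  shows "system_jacobian n F c d t q =
    Matrix.mat n n (\<lambda>(i, j). pderiv_expr (F i) j (nat (d j - c i)) t q)"
  unfolding system_jacobian_def
  using assms by (intro eq_matI) (auto simp: pderiv_expr_not_occ sigma_less_not_occ)

text \<open>Some term of the Leibniz expansion is nonzero. Its permutation is a transversal, and a
  Jacobian entry can be nonzero only where the inequality is an equality.\<close>

lemma valid_offsets_if_det_nonzero: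
  assumes le: "\<And>i j. i < n \<Longrightarrow> j < n \<Longrightarrow> sigma F i j \<le> Fin (d j - c i)"
    and det: "Determinant.det (system_jacobian n F c d t q) \<noteq> 0"
  shows "valid_offsets n F c d"
proof -
  let ?J = "system_jacobian n F c d t q"
  have "?J \<in> carrier_mat n n" by (simp add: system_jacobian_def)
  from det[unfolded det_def'[OF this]] obtain p where "p \<in> {p. p permutes {0..<n}}"
    and "signof p * (\<Prod>i = 0..<n. ?J $$ (i, p i)) \<noteq> 0"
    by (rule sum.not_neutral_contains_not_neutral)
  then have p: "p permutes {0..<n}" and "(\<Prod>i = 0..<n. ?J $$ (i, p i)) \<noteq> 0"
    by (blast, metis mult_zero_right)
  then have nz: "?J $$ (i, p i) \<noteq> 0" if "i < n" for i
    using that by simp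
  have pn: "p i < n" if "i < n" for i using permutes_in_image[OF p, of i] that by simp
  have ex1: "\<exists>!i. i < n \<and> p i = j" if "j < n" for j
  proof (rule ex1I)
    show "inv_into UNIV p j < n \<and> p (inv_into UNIV p j) = j"
      using permutes_inverses(1)[OF p] permutes_in_image[OF permutes_inv[OF p], of j] that by simp
    show "i = inv_into UNIV p j" if "i < n \<and> p i = j" for i
      using permutes_inverses(2)[OF p, of i] that by simp
  qed
  let ?T = "(\<lambda>i. (i, p i)) ` {..<n}"
  have "transversal n ?T"
    unfolding transversal_def
  proof (intro conjI allI impI)
    show "?T \<subseteq> {..<n} \<times> {..<n}" using pn by auto
    show "\<exists>!j. (i, j) \<in> ?T" if "i < n" for i
      using that by (intro ex1I[of _ "p i"]) auto
    show "\<exists>!i. (i, j) \<in> ?T" if "j < n" for j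
    proof -
      have "(i, j) \<in> ?T \<longleftrightarrow> i < n \<and> p i = j" for i by auto
      then show ?thesis using ex1[OF that] by simp
    qed
  qed
  moreover have "Fin (d (p i) - c i) = sigma F i (p i)" if "i < n" for i
    using nz[OF that] pn[OF that] that by (simp add: system_jacobian_def split: if_splits)
  ultimately show ?thesis
    unfolding valid_offsets_def using le by blast
qed

section \<open>Elimination of a bordering row and column\<close>

text \<open>This is the Schur complement of the corner entry 1, obtained by column operations that
  clear the rest of the last row.\<close>

lemma det_bordered:
  fixes f :: "nat \<Rightarrow> nat \<Rightarrow> 'a :: idom"
  assumes "f n n = 1"
  shows "Determinant.det (Matrix.mat (Suc n) (Suc n) (\<lambda>(i, j). f i j)) =
    Determinant.det (Matrix.mat n n (\<lambda>(i, j). f i j - f i n * f n j))"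
proof -
  let ?A = "Matrix.mat (Suc n) (Suc n) (\<lambda>(i, j). f i j)"
  let ?S = "Matrix.mat n n (\<lambda>(i, j). f i j - f i n * f n j)"
  \<comment> \<open>For \<open>j < n\<close>, right multiplication by this unit lower triangular
    matrix subtracts \<open>f n j\<close> times the last column from column \<open>j\<close>. The
    test \<open>i = j\<close> comes first, so the corner is 1.\<close>
  define b where "b i j = (if i = j then 1 else if i = n then - f n j else 0)" for i j
  let ?B = "Matrix.mat (Suc n) (Suc n) (\<lambda>(i, j). b i j)"
  have B: "Determinant.det ?B = 1"
  proof -
    have "Determinant.det ?B = prod_list (diag_mat ?B)"
      by (rule det_lower_triangular[of "Suc n"]) (auto simp: b_def)
    also have "\<dots> = 1"
      unfolding prod_list_diag_prod by (intro prod.neutral) (auto simp: b_def)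
    finally show ?thesis .
  qed
  have AB: "?A * ?B = four_block_mat ?S (Matrix.mat n 1 (\<lambda>(i, j). f i n)) (0\<^sub>m 1 n) (1\<^sub>m 1)"
  proof (rule eq_matI, goal_cases)
    case (1 i j)
    then have ij: "i < Suc n" "j < Suc n" by auto
    have "(?A * ?B) $$ (i, j) = (\<Sum>k<n. f i k * b k j) + f i n * b n j"
      using ij by (simp add: scalar_prod_def atLeast0LessThan)
    also have "(\<Sum>k<n. f i k * b k j) = (\<Sum>k<n. if k = j then f i j else 0)"
      by (intro sum.cong) (auto simp: b_def)
    finally have "(?A * ?B) $$ (i, j) = (\<Sum>k<n. if k = j then f i j else 0) + f i n * b n j" .
    also have "\<dots> = (if j < n then f i j - f i n * f n j else f i n)"
      using ij by (auto simp: b_def)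
    finally show ?case using ij assms by (auto simp: less_Suc_eq)
  qed auto
  have "Determinant.det ?A = Determinant.det (?A * ?B)"
    using B by (subst det_mult[of _ "Suc n"]) auto
  also have "\<dots> = Determinant.det ?S"
    unfolding AB by (subst det_four_block_mat_lower_left_zero[of _ n _ 1]) auto
  finally show ?thesis .
qed

text \<open>Either set may be empty, here when no equation is rewritten or when \<psi> contains no
  derivative; \<open>Min\<close> and \<open>Max\<close> are taken of nonempty sets only.\<close>

lemma finite_sets_separated:
  fixes A B :: "'a::linorder set"
  assumes "finite A" "finite B" "\<And>a b. a \<in> A \<Longrightarrow> b \<in> B \<Longrightarrow> a \<le> b"
  shows "\<exists>m. (\<forall>a\<in>A. a \<le> m) \<and> (\<forall>b\<in>B. m \<le> b)"
proof (cases "B = {}")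
  case True
  then show ?thesis using assms(1) by (cases "A = {}") (auto intro: exI[of _ "Max A"])
next
  case False
  then show ?thesis using assms by (intro exI[of _ "Min B"]) auto
qed

section \<open>Amenability of the enlarged system\<close>

theorem theorem3p2:
  fixes n :: nat and F Fbar :: "nat \<Rightarrow> expr" and \<psi> :: expr and R :: "nat set"
  assumes "is_dae n F"
    and "scalar_expr_of n F \<psi>"
    and "R \<subseteq> {..<n}"
    and "\<And>r. r \<in> R \<Longrightarrow> (replace1 \<psi> (Der n 0))\<^sup>+\<^sup>+ (F r) (Fbar r)"
    and "\<And>i. i < n \<Longrightarrow> i \<notin> R \<Longrightarrow> Fbar i = F i"
    and "Fbar n = Minus (Der n 0) \<psi>"
    and "S_amenable n F"
  shows "S_amenable (Suc n) Fbar"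
proof -
  obtain c d t q I x where valid: "valid_offsets n F c d"
    and sol: "is_solution n F I x" and tI: "t \<in> I"
    and q: "\<And>j k. (j, k) \<in> dae_occ n F \<Longrightarrow> q j k = jet x t j k"
    and det: "Determinant.det (system_jacobian n F c d t q) \<noteq> 0"
    using assms(7) unfolding S_amenable_def consistent_point_def by blast
  have smooth_F: "smooth (F i)" if "i < n" for i
    using assms(1) that by (auto simp: is_dae_def)
  have occ_F: "j < n" if "(j, k) \<in> occ (F i)" "i < n" for i j k
    using assms(1) that by (auto simp: is_dae_def)
  have smooth_\<psi>: "smooth \<psi>" and occ_\<psi>_dae: "occ \<psi> \<subseteq> dae_occ n F"
    and defined_\<psi>: "\<And>t q. (\<And>i. i < n \<Longrightarrow> defined_at t q (F i)) \<Longrightarrow> defined_at t q \<psi>"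
    using assms(2) by (auto simp: scalar_expr_of_def)
  have occ_dae: "j < n" if "(j, k) \<in> dae_occ n F" for j k
    using that occ_F by (auto simp: dae_occ_def)
  have occ_\<psi>: "j < n" if "(j, k) \<in> occ \<psi>" for j k
    using that occ_\<psi>_dae occ_dae by blast
  have occ_bar: "occ (Fbar i) \<subseteq> insert (n, 0) (occ (F i))" if "i < n" for i
    using replace_occ[OF assms(4)[of i]] assms(5)[OF that] by (cases "i \<in> R") auto
  have occ_bar_n: "occ (Fbar n) = insert (n, 0) (occ \<psi>)"
    by (simp add: assms(6) Minus_def)

  have occ_le: "int k \<le> d j - c i" if "(j, k) \<in> occ (F i)" "i < n" for i j k
    using valid that occ_F[OF that] unfolding valid_offsets_def sigma_le_iff by blast

  text \<open>
    The offset \<open>m\<close> of both the new equation and the new unknown. It exists because every derivative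
    in \<open>\<psi>\<close> occurs in each \<open>F r\<close>, \<open>r \<in> R\<close>.
  \<close>
  have fin_R: "finite R" using assms(3) finite_subset by blast
  have "\<exists>m. (\<forall>a\<in>c ` R. a \<le> m) \<and> (\<forall>b\<in>(\<lambda>(j, k). d j - int k) ` occ \<psi>. m \<le> b)"
  proof (rule finite_sets_separated)
    show "a \<le> b" if "a \<in> c ` R" "b \<in> (\<lambda>(j, k). d j - int k) ` occ \<psi>" for a b
      using that replace_occ_subexpr[OF assms(4)] assms(3) by (force dest!: occ_le)
  qed (use fin_R finite_occ in auto)
  then obtain m where m_R: "\<And>r. r \<in> R \<Longrightarrow> c r \<le> m"
    and m_\<psi>: "\<And>j k. (j, k) \<in> occ \<psi> \<Longrightarrow> m \<le> d j - int k"
    by fastforce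
  define c' where "c' = c(n := m)"
  define d' where "d' = d(n := m)"
  \<comment> \<open>The inequalities come first; a transversal with equality is obtained at the end
    from the determinant.\<close>
  have le': "sigma Fbar i j \<le> Fin (d' j - c' i)" if "i < Suc n" "j < Suc n" for i j
    unfolding sigma_le_iff
  proof (intro allI impI)
    fix k assume k: "(j, k) \<in> occ (Fbar i)"
    show "int k \<le> d' j - c' i"
    proof (cases "i = n")
      case True
      with k occ_bar_n consider "(j, k) = (n, 0)" | "(j, k) \<in> occ \<psi>" by auto
      then show ?thesis
        using True m_\<psi>[of j k] occ_\<psi>[of j k] by cases (auto simp: c'_def d'_def)
    next
      case False
      then have i: "i < n" using that by simp
      show ?thesis
      proof (cases "(j, k) \<in> occ (F i)")
        case True
        then show ?thesis using occ_le[OF True i] occ_F[OF True i] i by (simp add: c'_def d'_def)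
      next
        case False
        \<comment> \<open>A derivative new to row \<open>i\<close> can only be \<open>u\<close>
          itself, of order 0, and the bound becomes \<open>c i \<le> m\<close>.\<close>
        then have "(j, k) = (n, 0)" using k occ_bar[OF i] by blast
        moreover have "i \<in> R" using False k assms(5)[OF i] by metis
        ultimately show ?thesis using m_R i by (simp add: c'_def d'_def)
      qed
    qed
  qed

  define x' where "x' = x(n := \<lambda>s. eval s (jet x s) \<psi>)"
  have jet_x': "jet x' s j k = jet x s j k" if "j < n" for s j k
    using that by (simp add: x'_def jet_def)
  have jet_x'_n: "jet x' s n 0 = eval s (jet x s) \<psi>" for s
    by (simp add: x'_def jet_def)
  \<comment> \<open>Since \<psi> contains only derivatives occurring in \<open>F\<close>, the new
    system asks no further smoothness of the old unknowns.\<close>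
  have occ_bar_dae: "(j, k) = (n, 0) \<or> (j, k) \<in> dae_occ n F"
    if "(j, k) \<in> dae_occ (Suc n) Fbar" for j k
    using that occ_bar occ_bar_n occ_\<psi>_dae by (fastforce simp: dae_occ_def less_Suc_eq)
  have defined_F: "defined_at s (jet x s) (F i)" and eval_F: "eval s (jet x s) (F i) = 0"
    if "s \<in> I" "i < n" for s i
    using sol that by (auto simp: is_solution_def)
  have sol': "is_solution (Suc n) Fbar I x'"
    unfolding is_solution_def
  proof (intro conjI ballI allI impI)
    show "open I" "is_interval I" "I \<noteq> {}" using sol by (auto simp: is_solution_def)
    have Ck: "Ck_on k I (x j)" if "(j, k) \<in> dae_occ n F" for j k
      using sol that by (auto simp: is_solution_def)
    have "continuous_on I (\<lambda>s. eval s (jet x s) \<psi>)"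
      by (rule continuous_on_eval_jet)
        (use smooth_\<psi> defined_\<psi> defined_F Ck occ_\<psi>_dae in auto)
    then have "Ck_on 0 I (x' n)" by (simp add: Ck_on_def x'_def)
    then show "case p of (j, k) \<Rightarrow> Ck_on k I (x' j)" if "p \<in> dae_occ (Suc n) Fbar" for p
      using that Ck occ_dae occ_bar_dae by (cases p) (fastforce simp: x'_def)
    fix s i assume s: "s \<in> I" and "i < Suc n"
    \<comment> \<open>\<psi> involves only old unknowns, on which \<open>x'\<close> agrees with
      \<open>x\<close>. So replaced and original equations have equal values along
      \<open>x'\<close>.\<close>
    have \<psi>': "eval s (jet x' s) \<psi> = jet x' s n 0"
      unfolding jet_x'_n by (rule eval_cong) (simp add: jet_x' occ_\<psi>)
    have F': "eval s (jet x' s) (F i) = 0" "defined_at s (jet x' s) (F i)" if "i < n" for i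
      using eval_F[OF s that] defined_F[OF s that]
        eval_cong[of "F i" "jet x' s" "jet x s"] defined_at_cong[of "F i" "jet x' s" "jet x s"]
      by (simp_all add: jet_x' occ_F that)
    have "defined_at s (jet x' s) \<psi>" using F'(2) defined_\<psi> by blast
    then show "defined_at s (jet x' s) (Fbar i)" "eval s (jet x' s) (Fbar i) = 0"
      using \<open>i < Suc n\<close> F' \<psi>' assms(5)[of i]
        replace_eval[OF assms(4)[of i]] replace_defined_at[OF assms(4)[of i]]
      by (cases "i = n"; cases "i \<in> R"; simp add: assms(6) Minus_def)+
  qed

  \<comment> \<open>Changing the single coordinate of \<open>u\<close> puts the point on the graph
    of \<psi>, while the partial derivatives of \<open>F\<close> keep their values.\<close>
  define q' where "q' = upd q n 0 (eval t q \<psi>)"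
  have q'_eq: "q' j k = q j k" if "j < n" for j k using that by (simp add: q'_def)
  have "eval t q' \<psi> = eval t q \<psi>" by (rule eval_cong) (auto simp: q'_eq dest: occ_\<psi>)
  then have eval_\<psi>: "eval t q' \<psi> = q' n 0" by (simp add: q'_def)
  have consistent: "consistent_point (Suc n) Fbar t q'"
    unfolding consistent_point_def
  proof (intro exI conjI)
    have "eval t q \<psi> = eval t (jet x t) \<psi>"
      by (rule eval_cong) (use q occ_\<psi>_dae in blast)
    then have "q' n 0 = jet x' t n 0" by (simp add: q'_def jet_x'_n)
    then show "\<forall>(j, k)\<in>dae_occ (Suc n) Fbar. q' j k = jet x' t j k"
      using occ_bar_dae occ_dae q by (fastforce simp: q'_eq jet_x')
  qed (fact sol' tI)+
  \<comment> \<open>\<open>q\<close> is tied to the solution only at occurring derivatives, so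
    definedness is carried over from the solution through these.\<close>
  have defined_q': "defined_at t q' (F i)" if "i < n" for i
  proof -
    have "q' j k = jet x t j k" if "(j, k) \<in> occ (F i)" for j k
      using that q'_eq occ_F[OF that \<open>i < n\<close>] q[of j k] \<open>i < n\<close> by (auto simp: dae_occ_def)
    then show ?thesis using defined_at_cong[of "F i" q' "jet x t"] defined_F[OF tI that] by blast
  qed
  have defined_\<psi>_q': "defined_at t q' \<psi>" using defined_q' defined_\<psi> by blast

  \<comment> \<open>These are the new Jacobian entries without the case distinction. The corner has
    order \<open>m - m = 0\<close>, where \<open>u - \<psi>\<close> has derivative 1 in
    \<open>u\<close>.\<close>
  define f where "f i j = pderiv_expr (Fbar i) j (nat (d' j - c' i)) t q'" for i j
  have f_n: "f n j = (if j = n then 1 else - pderiv_expr \<psi> j (nat (d j - m)) t q')" for j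
  proof -
    have "pderiv_expr \<psi> n k t q' = 0" for k
      by (rule pderiv_expr_not_occ) (use occ_\<psi> in blast)
    then show ?thesis
      unfolding f_def assms(6)
      using pderiv_expr_Minus[of "Der n 0" t q' \<psi>] smooth_\<psi> defined_\<psi>_q'
      by (simp add: pderiv_expr_Der c'_def d'_def)
  qed

  text \<open>
    When \<open>c r < m\<close>, both correction terms vanish: \<open>\<psi>\<close> is of order at most \<open>d j - m\<close> in \<open>x j\<close>,
    hence does not contain the derivative of order \<open>d j - c r\<close>.
  \<close>
  have schur: "f i j - f i n * f n j = pderiv_expr (F i) j (nat (d j - c i)) t q"
    if ij: "i < n" "j < n" for i j
  proof -
    let ?k = "nat (d j - c i)"
    have F_q: "pderiv_expr (F i) j ?k t q' = pderiv_expr (F i) j ?k t q"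
      by (rule pderiv_expr_cong) (simp add: q'_eq occ_F ij)
    have f_ij: "f i j = pderiv_expr (Fbar i) j ?k t q'"
      using ij by (simp add: f_def c'_def d'_def)
    have f_in: "f i n = pderiv_expr (Fbar i) n (nat (m - c i)) t q'"
      using ij by (simp add: f_def c'_def d'_def)
    show ?thesis
    proof (cases "i \<in> R")
      case False
      then have "Fbar i = F i" using assms(5) ij by blast
      moreover from this have "f i n = 0"
        unfolding f_in using occ_F[of n _ i] ij by (auto intro: pderiv_expr_not_occ)
      ultimately show ?thesis using f_ij F_q by simp
    next
      case True
      note rep = assms(4)[OF True]
      have "(n, 0) \<notin> occ (F i)" "(n, 0) \<notin> occ \<psi>"
        using occ_F[of n 0 i] occ_\<psi>[of n 0] ij by auto
      \<comment> \<open>The chain rule yields the derivative of \<psi> of order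
        \<open>d j - c i\<close>, whereas the last row contains that of order
        \<open>d j - m\<close>; they match when \<open>m = c i\<close>.\<close>
      then have chain: "pderiv_expr (F i) j ?k t q' = pderiv_expr (Fbar i) j ?k t q' +
          pderiv_expr (Fbar i) n 0 t q' * pderiv_expr \<psi> j ?k t q'"
        by (intro pderiv_expr_subst)
          (use ij rep eval_\<psi> smooth_\<psi> defined_\<psi>_q' smooth_F[of i] defined_q'[of i]
            replace_smooth[OF rep] replace_defined_at[OF rep] replace_eval[OF rep] in auto)
      show ?thesis
      proof (cases "m = c i")
        case True
        then show ?thesis using chain ij F_q by (simp add: f_ij f_in f_n)
      next
        case False
        with m_R[OF \<open>i \<in> R\<close>] have less: "c i < m" by simp
        \<comment> \<open>The order \<open>m - c i\<close> is positive, but \<open>u\<close> occurs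
          in \<open>Fbar i\<close> at most with order 0.\<close>
        have "(n, nat (m - c i)) \<notin> insert (n, 0) (occ (F i))"
          using less occ_F[of n _ i] ij by auto
        then have "(n, nat (m - c i)) \<notin> occ (Fbar i)" using occ_bar[OF ij(1)] by blast
        then have "f i n = 0" unfolding f_in by (rule pderiv_expr_not_occ)
        moreover have "(j, ?k) \<notin> occ \<psi>"
          using m_\<psi>[of j ?k] less by linarith
        ultimately show ?thesis using chain F_q by (simp add: f_ij pderiv_expr_not_occ)
      qed
    qed
  qed
  \<comment> \<open>Validity of the new offsets is not yet known at this point; the rewriting of the
    Jacobian rests on the inequalities \<open>le'\<close>.\<close>
  have "Determinant.det (system_jacobian (Suc n) Fbar c' d' t q') =
      Determinant.det (Matrix.mat (Suc n) (Suc n) (\<lambda>(i, j). f i j))"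
    unfolding f_def by (subst system_jacobian_eq[OF le']) simp_all
  also have "\<dots> = Determinant.det (Matrix.mat n n (\<lambda>(i, j). f i j - f i n * f n j))"
    by (rule det_bordered) (simp add: f_n)
  also have "Matrix.mat n n (\<lambda>(i, j). f i j - f i n * f n j) = system_jacobian n F c d t q"
    using valid by (subst system_jacobian_eq)
      (auto simp: valid_offsets_def schur intro!: eq_matI)
  finally have "Determinant.det (system_jacobian (Suc n) Fbar c' d' t q') \<noteq> 0"
    using det by simp
  then show ?thesis
    unfolding S_amenable_def using valid_offsets_if_det_nonzero[OF le'] consistent by blast
qed

end
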